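(* For any $h\in\mathbb{Z}[X]\setminus\{0\}$ there are infinitely many $h$-Schenker primes.
   Context: $\mathbb{N}=\{0,1,2,\dots\}$ and $0^0=1$. For $h\in\mathbb{Z}[X]$ the sequence of $h$-Schenker sums is $a_n=\sum_{j=0}^n\frac{n!}{j!}h(n)^j$, $n\in\mathbb{N}$. A prime number $p$ is called an $h$-Schenker prime if $p\mid a_n$ and $p\nmid h(n)$ for some $n\in\mathbb{N}$. *)

theory Defs
  imports "HOL-Computational_Algebra.Computational_Algebra"
begin

(* For j \<le> n the integer division below is exact, see schenker_sum_of_int. *)
definition schenker_sum :: "int poly \<Rightarrow> nat \<Rightarrow> int" where
  "schenker_sum h n = (\<Sum>j=0..n. (fact n div fact j) * poly h (int n) ^ j)"

lemma schenker_sum_of_int: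
  "(of_int (schenker_sum h n) :: 'a::field_char_0) =
     (\<Sum>j=0..n. fact n / fact j * of_int (poly h (int n)) ^ j)"
proof -
  have "(of_int (fact n div fact j) :: 'a) = fact n / fact j" if "j \<le> n" for j
  proof -
    have "(fact j :: int) dvd fact n"
      using that by (rule fact_dvd)
    then show ?thesis
      by (simp add: of_int_divide_in_Ints of_int_div)
  qed
  then show ?thesis
    unfolding schenker_sum_def of_int_sum
    by (intro sum.cong) simp_all
qed

definition schenker_prime :: "int poly \<Rightarrow> nat \<Rightarrow> bool" where
  "schenker_prime h p \<longleftrightarrow>
     prime p \<and> (\<exists>n::nat. int p dvd schenker_sum h n \<and> \<not> int p dvd poly h (int n))"

end

theory Submission
  imports Defs "HOL-Real_Asymp.Real_Asymp"
begin

text \<open>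
  Suppose there are only finitely many Schenker primes and let \<open>n\<close> be divisible by all of them.
  Since \<open>a\<^sub>n\<close> is congruent to \<open>h(n)\<^sup>n\<close> modulo every prime factor of \<open>n\<close>, every prime dividing \<open>a\<^sub>n\<close>
  also divides \<open>h(n)\<close>. For such a prime \<open>p\<close> the summand \<open>n!\<close> is the unique one of minimal
  \<open>p\<close>-adic valuation, so \<open>a\<^sub>n\<close> divides \<open>n!\<close>. This contradicts the size of \<open>a\<^sub>n\<close> if
  \<open>h(n) > 0\<close> or \<open>- h(n) > n\<close> for all large \<open>n\<close>. The remaining polynomials are the negative
  constants and \<open>c - X\<close> with \<open>c \<ge> 0\<close>. For \<open>h = - X\<close> one has \<open>a\<^sub>1 = 0\<close>. Otherwise \<open>h(0) \<noteq> 0\<close>;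
  fix a prime \<open>q\<close> not dividing \<open>h(0)\<close>. For \<open>n\<close> divisible by \<open>q\<close> the prime \<open>q\<close> divides neither
  \<open>h(n)\<close> nor \<open>a\<^sub>n\<close>, hence \<open>\<bar>a\<^sub>n\<bar> q\<^bsup>n/q\<^esup> \<le> n!\<close>. For even \<open>n\<close>, Taylor's theorem
  with Lagrange remainder shows that \<open>n! / a\<^sub>n\<close> grows at most polynomially, a contradiction.
\<close>

section \<open>Valuations of factorials at a prime\<close>

lemma multiplicity_fact_mult_add:
  fixes p :: nat
  assumes "prime p" "r < p"
  shows "multiplicity p (fact (p * k + r) :: nat) = multiplicity p (fact (p * k) :: nat)"
  using assms(2)
proof (induction r)
  case (Suc r)
  have "\<not> p dvd Suc (p * k + r)"
    using Suc.prems by (metis add_Suc_right dvd_add_right_iff dvd_triv_left nat_dvd_not_less zero_less_Suc)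
  then have "multiplicity p (Suc (p * k + r)) = 0"
    by (rule not_dvd_imp_multiplicity_0)
  then show ?case
    using Suc assms(1) by (simp add: prime_elem_multiplicity_mult_distrib del: mult_Suc)
qed simp

text \<open>Passing from \<open>k\<close> to \<open>Suc k\<close> adds \<open>p\<close> factors to
  the factorial, and only \<open>p * Suc k\<close> among them is divisible by
  \<open>p\<close>.\<close>

lemma multiplicity_fact_mult:
  fixes p :: nat
  assumes "prime p"
  shows "multiplicity p (fact (p * k) :: nat) = k + multiplicity p (fact k :: nat)"
proof (induction k)
  case (Suc k)
  obtain r where r: "p = Suc r"
    using assms prime_gt_0_nat gr0_implies_Suc by blast
  have "(fact (p * Suc k) :: nat) = p * (Suc k * fact (p * k + r))"
    by (simp add: r algebra_simps)
  moreover have "multiplicity p (fact (p * k + r) :: nat) = multiplicity p (fact (p * k) :: nat)"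
    using assms r by (intro multiplicity_fact_mult_add) auto
  ultimately have "multiplicity p (fact (p * Suc k) :: nat)
      = 1 + multiplicity p (Suc k) + multiplicity p (fact (p * k) :: nat)"
    using assms by (simp add: prime_elem_multiplicity_mult_distrib multiplicity_self prime_elem_not_unit del: mult_Suc mult_Suc_right)
  then show ?case
    using Suc assms by (simp add: prime_elem_multiplicity_mult_distrib del: mult_Suc mult_Suc_right)
qed simp

text \<open>One step of Legendre's formula. It drives the recursion on \<open>n div p\<close> and
  shows that \<open>p ^ (n div p)\<close> divides \<open>n!\<close>.\<close>

lemma multiplicity_fact_div:
  fixes p :: nat
  assumes "prime p"
  shows "multiplicity p (fact n :: nat) = n div p + multiplicity p (fact (n div p) :: nat)"
  using multiplicity_fact_mult_add[OF assms, of "n mod p" "n div p"]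
    multiplicity_fact_mult[OF assms, of "n div p"] prime_gt_0_nat[OF assms]
  by simp

text \<open>With \<open>k = n div p > 0\<close>, strong induction bounds the valuation strictly by
  \<open>k + k\<close>, which is at most \<open>n\<close> because \<open>p\<close> is at least
  2.\<close>

lemma multiplicity_fact_less:
  fixes p :: nat
  assumes "prime p" "n > 0"
  shows "multiplicity p (fact n :: nat) < n"
  using assms(2)
proof (induction n rule: less_induct)
  case (less n)
  have p: "p \<ge> 2"
    using assms(1) by (rule prime_ge_2_nat)
  then have half: "2 * (n div p) \<le> n"
    by (metis div_times_less_eq_dividend le_trans mult.commute mult_le_mono1)
  show ?case
  proof (cases "n div p = 0")
    case False
    then have "multiplicity p (fact (n div p) :: nat) < n div p"
      using less p by (intro less.IH) auto
    then show ?thesis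
      using half multiplicity_fact_div[OF assms(1), of n] by simp
  qed (use less multiplicity_fact_div[OF assms(1), of n] in simp)
qed

section \<open>Recurrence and prime divisors of the sums\<close>

text \<open>This is \<open>n!\<close> times the exponential series cut off after degree
  \<open>n\<close>. The argument \<open>x\<close> is freed from \<open>h(n)\<close>, which moves
  with \<open>n\<close>, so that induction on \<open>n\<close> is possible.\<close>

definition scaled_exp :: "int \<Rightarrow> nat \<Rightarrow> int" where
  "scaled_exp x n = (\<Sum>j=0..n. (fact n div fact j) * x ^ j)"

lemma schenker_sum_eq: "schenker_sum h n = scaled_exp (poly h (int n)) n"
  by (simp add: schenker_sum_def scaled_exp_def)

lemma of_int_scaled_exp:
  "(of_int (scaled_exp x n) :: 'a::field_char_0) = (\<Sum>j=0..n. fact n / fact j * of_int x ^ j)"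
  using schenker_sum_of_int[of "[:x:]" n] by (simp add: schenker_sum_eq)

lemma scaled_exp_0 [simp]: "scaled_exp x 0 = 1"
  by (simp add: scaled_exp_def)

lemma scaled_exp_Suc: "scaled_exp x (Suc n) = int (Suc n) * scaled_exp x n + x ^ Suc n"
proof -
  have "(fact (Suc n) div fact j :: int) * x ^ j = int (Suc n) * ((fact n div fact j) * x ^ j)"
    if "j \<le> n" for j
    using fact_dvd[OF that, where ?'a = int] by (simp add: div_mult_swap mult.assoc)
  then show ?thesis
    unfolding scaled_exp_def sum.atLeast0_atMost_Suc sum_distrib_left
    by (intro arg_cong2[of _ _ _ _ "(+)"] sum.cong) (auto simp del: of_nat_Suc fact_Suc)
qed

lemma scaled_exp_gt_fact:
  assumes "x > 0" "n > 0"
  shows "scaled_exp x n > fact n"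
proof -
  have ge: "scaled_exp x n \<ge> fact n" for n
    using assms(1) by (induction n) (simp_all add: scaled_exp_Suc add_increasing2 mult_left_mono del: of_nat_Suc)
  obtain k where "n = Suc k"
    using assms(2) gr0_implies_Suc by blast
  then have "fact n \<le> int n * scaled_exp x k"
    using ge[of k] by (simp add: mult_left_mono del: of_nat_Suc)
  then show ?thesis
    using assms(1) unfolding \<open>n = Suc k\<close> scaled_exp_Suc
    by (intro less_le_trans[OF less_add_same_cancel1[THEN iffD2] add_right_mono]) auto
qed

lemma multiplicity_of_nat: "multiplicity (int p) (int n) = multiplicity p n"
  by (simp add: multiplicity_def flip: of_nat_power)

text \<open>In the recurrence the first summand has the valuation of \<open>(n+1)!\<close>, which is
  less than \<open>n+1\<close>, while \<open>p ^ (n+1)\<close> divides \<open>x ^ (n+1)\<close>; so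
  the first summand decides. Nonvanishing is carried along since \<open>multiplicity\<close> is 0 at
  0.\<close>

lemma scaled_exp_multiplicity:
  fixes p :: nat
  assumes "prime p" "int p dvd x"
  shows "scaled_exp x n \<noteq> 0 \<and> multiplicity (int p) (scaled_exp x n) = multiplicity p (fact n :: nat)"
proof (induction n)
  case (Suc n)
  let ?a = "int (Suc n) * scaled_exp x n"
  have a: "?a \<noteq> 0"
    using Suc by simp
  have "multiplicity (int p) ?a = multiplicity (int p) (int (Suc n)) + multiplicity p (fact n :: nat)"
    using Suc assms(1) by (subst prime_elem_multiplicity_mult_distrib) auto
  also have "\<dots> = multiplicity p (fact (Suc n) :: nat)"
    using assms(1) unfolding multiplicity_of_nat by (simp add: prime_elem_multiplicity_mult_distrib del: mult_Suc)
  finally have m: "multiplicity (int p) ?a = multiplicity p (fact (Suc n) :: nat)" .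
  also have "\<dots> < Suc n"
    using assms(1) by (intro multiplicity_fact_less) auto
  finally have "\<not> int p ^ Suc n dvd ?a"
    using a assms(1) by (subst power_dvd_iff_le_multiplicity) auto
  moreover have x: "int p ^ Suc n dvd x ^ Suc n"
    using assms(2) by (rule dvd_power_same)
  ultimately have nd: "\<not> int p ^ Suc n dvd scaled_exp x (Suc n)"
    by (simp only: scaled_exp_Suc dvd_add_left_iff) simp
  have "multiplicity (int p) (?a + x ^ Suc n) = multiplicity (int p) ?a"
  proof (cases "x = 0")
    case False
    then have "Suc n \<le> multiplicity (int p) (x ^ Suc n)"
      using x assms(1) by (intro multiplicity_geI) auto
    then show ?thesis
      using a False assms(1) m \<open>multiplicity p (fact (Suc n) :: nat) < Suc n\<close>
      by (intro multiplicity_sum_lt) auto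
  qed simp
  then show ?case
    using nd m by (auto simp: scaled_exp_Suc)
qed simp

text \<open>If \<open>p\<close> divides \<open>n > 0\<close>, the recurrence leaves only
  \<open>x ^ n\<close> modulo \<open>p\<close>; for \<open>n = 0\<close> the sum is 1.\<close>

lemma scaled_exp_not_dvd:
  fixes p :: nat
  assumes "prime p" "p dvd n" "\<not> int p dvd x"
  shows "\<not> int p dvd scaled_exp x n"
proof (cases n)
  case (Suc k)
  have "int p dvd int (Suc k) * scaled_exp x k"
    using assms(2) Suc by (metis dvd_mult2 of_nat_dvd_iff)
  moreover have "\<not> int p dvd x ^ Suc k"
    using assms(1,3) prime_dvd_power[of "int p" x "Suc k"] by auto
  ultimately show ?thesis
    unfolding Suc scaled_exp_Suc by (simp only: dvd_add_right_iff) simp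
qed (use assms in auto)

lemma scaled_exp_dvd_fact:
  assumes "\<And>p::nat. prime p \<Longrightarrow> int p dvd scaled_exp x n \<Longrightarrow> int p dvd x"
  shows "scaled_exp x n dvd fact n"
proof -
  \<comment> \<open>If the sum were 0, then 2 would divide it, hence also \<open>x\<close>, and the
    valuation lemma for 2 would make the sum nonzero.\<close>
  have nz: "scaled_exp x n \<noteq> 0"
    using assms[OF two_is_prime_nat] scaled_exp_multiplicity[OF two_is_prime_nat] by fastforce
  show "scaled_exp x n dvd fact n"
  proof (rule multiplicity_le_imp_dvd[OF nz])
    fix p :: int
    assume "prime p"
    then obtain q where q: "p = int q" "prime q"
      by (metis prime_int_nat_transfer prime_ge_0_int int_nat_eq)
    have "multiplicity (int q) (int (fact n)) = multiplicity q (fact n :: nat)"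
      by (rule multiplicity_of_nat)
    then show "multiplicity p (scaled_exp x n) \<le> multiplicity p (fact n)"
      using assms[of q] q scaled_exp_multiplicity[of q x n]
      by (cases "int q dvd scaled_exp x n") (auto simp: not_dvd_imp_multiplicity_0)
  qed
qed

text \<open>The sum and \<open>q ^ (n div q)\<close> both divide \<open>n!\<close>, and they are
  coprime because \<open>q\<close> does not divide \<open>x\<close>; so their product divides
  \<open>n!\<close>.\<close>

lemma scaled_exp_times_prime_power_le_fact:
  fixes q :: nat
  assumes "\<And>p::nat. prime p \<Longrightarrow> int p dvd scaled_exp x n \<Longrightarrow> int p dvd x"
    and "prime q" "\<not> int q dvd x"
  shows "\<bar>scaled_exp x n\<bar> * int q ^ (n div q) \<le> fact n"
proof -
  have "q ^ (n div q) dvd (fact n :: nat)"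
    using multiplicity_fact_div[OF assms(2), of n] by (intro multiplicity_dvd') simp
  then have "int (q ^ (n div q)) dvd int (fact n)"
    by (simp only: of_nat_dvd_iff)
  then have "int q ^ (n div q) dvd fact n"
    by simp
  moreover have "coprime (scaled_exp x n) (int q ^ (n div q))"
  proof -
    have "coprime (int q) (scaled_exp x n)"
      using assms by (intro prime_imp_coprime) auto
    then show ?thesis by (simp add: coprime_commute)
  qed
  ultimately have "scaled_exp x n * int q ^ (n div q) dvd fact n"
    using scaled_exp_dvd_fact[OF assms(1)] by (intro divides_mult) auto
  then have "\<bar>scaled_exp x n * int q ^ (n div q)\<bar> \<le> \<bar>fact n\<bar>"
    by (intro dvd_imp_le_int) auto
  then show ?thesis
    by (simp add: abs_mult)
qed

section \<open>Size of the sums at negative arguments\<close>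

lemma fact_Suc_le_power: "fact (Suc k) \<le> int (Suc k) ^ k"
proof (induction k)
  case (Suc k)
  have "fact (Suc (Suc k)) \<le> int (Suc (Suc k)) * int (Suc k) ^ k"
    using Suc by (simp add: mult_left_mono del: of_nat_Suc)
  also have "\<dots> \<le> int (Suc (Suc k)) * int (Suc (Suc k)) ^ k"
    by (intro mult_left_mono power_mono) auto
  finally show ?case by simp
qed simp

text \<open>For \<open>m > n\<close> the summands increase in absolute value, so the alternating sum is governed by its last two.\<close>

lemma scaled_exp_neg_large:
  assumes "m \<ge> int n + 1" "n \<ge> 2"
  shows "\<bar>scaled_exp (- m) n\<bar> > fact n"
proof -
  \<comment> \<open>The sign makes the top summand positive. The invariant
    \<open>0 \<le> T k \<le> m ^ k\<close> then survives the recurrence because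
    \<open>k + 1 \<le> m\<close>.\<close>
  define T where "T k = (- 1) ^ k * scaled_exp (- m) k" for k
  have T_Suc: "T (Suc k) = m ^ Suc k - int (Suc k) * T k" for k
  proof -
    have "(- 1) ^ Suc k * (- m) ^ Suc k = m ^ Suc k"
      by (simp flip: power_mult_distrib del: power_Suc)
    moreover have "T (Suc k) = (- 1) ^ Suc k * (- m) ^ Suc k - int (Suc k) * T k"
      unfolding T_def scaled_exp_Suc power_Suc by algebra
    ultimately show ?thesis by simp
  qed
  have T: "0 \<le> T k \<and> T k \<le> m ^ k" if "k \<le> n" for k
    using that
  proof (induction k)
    case (Suc k)
    have "int (Suc k) * T k \<le> m * m ^ k"
      using Suc assms(1) by (intro mult_mono) auto
    then show ?case
      using Suc by (simp add: T_Suc)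
  qed (simp add: T_def)
  obtain k where k: "n = Suc k" "k > 0"
    using assms(2) by (cases n) auto
  \<comment> \<open>Strictness comes from \<open>k > 0\<close>, that is, from
    \<open>n \<ge> 2\<close>.\<close>
  have "(fact n :: int) < (int n + 1) ^ k"
    using fact_Suc_le_power[of k] k
      power_strict_mono[of "int n" "int n + 1" k] by (simp del: of_nat_Suc fact_Suc)
  also have "\<dots> \<le> m ^ k"
    using assms(1) by (intro power_mono) auto
  also have "\<dots> \<le> (m - int n) * m ^ k"
    using assms(1) mult_right_mono[of 1 "m - int n" "m ^ k"] by simp
  also have "\<dots> \<le> T n"
    using mult_left_mono[of "T k" "m ^ k" "int n"] T[of k] k by (simp add: T_Suc left_diff_distrib)
  also have "\<dots> \<le> \<bar>T n\<bar>"
    by (rule abs_ge_self)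
  also have "\<dots> = \<bar>scaled_exp (- m) n\<bar>"
    by (simp add: T_def abs_mult)
  finally show ?thesis .
qed

text \<open>The second summand is the Lagrange remainder. The bound without it is too weak for \<open>h = c - X\<close>.\<close>

lemma scaled_exp_neg_even:
  assumes "even n" "m \<ge> 0"
  shows "real_of_int (scaled_exp (- m) n)
    \<ge> fact n * exp (- real_of_int m) * (1 + real_of_int m ^ Suc n / fact (Suc n))"
proof -
  let ?m = "real_of_int m"
  obtain t where t: "\<bar>t\<bar> \<le> \<bar>- ?m\<bar>"
    "exp (- ?m) = (\<Sum>j<Suc n. (- ?m) ^ j / fact j) + exp t / fact (Suc n) * (- ?m) ^ Suc n"
    using Maclaurin_exp_le by blast
  have "real_of_int (scaled_exp (- m) n) = fact n * (\<Sum>j<Suc n. (- ?m) ^ j / fact j)"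
    by (simp add: of_int_scaled_exp sum_distrib_left atLeast0AtMost lessThan_Suc_atMost del: sum.lessThan_Suc)
  \<comment> \<open>Since \<open>n + 1\<close> is odd, the remainder changes sign and becomes
    positive on this side; it is bounded below through \<open>exp t \<ge> exp (- m)\<close>.\<close>
  also have "(\<Sum>j<Suc n. (- ?m) ^ j / fact j) = exp (- ?m) + exp t / fact (Suc n) * ?m ^ Suc n"
    using t(2) assms(1) by (simp del: sum.lessThan_Suc fact_Suc)
  also have "fact n * (exp (- ?m) + exp t / fact (Suc n) * ?m ^ Suc n)
    \<ge> fact n * (exp (- ?m) + exp (- ?m) / fact (Suc n) * ?m ^ Suc n)"
    using t(1) assms(2) by (intro mult_left_mono add_left_mono mult_right_mono divide_right_mono) auto
  finally show ?thesis
    by (simp add: algebra_simps del: fact_Suc)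
qed

text \<open>A crude Stirling bound, by induction from
  \<open>(1 - 1/(n+1)) ^ (n+1) \<le> exp (- 1)\<close>. The lost polynomial factor is
  harmless.\<close>

lemma fact_le_exp:
  assumes "n > 0"
  shows "fact n \<le> real n ^ Suc n * exp (1 - real n)"
  using assms
proof (induction n rule: nat_induct_non_zero)
  case (Suc n)
  have "(1 - 1 / real (Suc n)) ^ Suc n \<le> exp (- 1)"
    by (rule exp_ge_one_minus_x_over_n_power_n) auto
  then have "(real n / real (Suc n)) ^ Suc n \<le> exp (- 1)"
    by (simp add: field_simps)
  then have *: "real n ^ Suc n \<le> real (Suc n) ^ Suc n * exp (- 1)"
    by (simp add: field_simps power_divide del: power_Suc of_nat_Suc)
  have "fact (Suc n) \<le> real (Suc n) * (real n ^ Suc n * exp (1 - real n))"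
    using Suc by (simp add: mult_left_mono del: of_nat_Suc power_Suc)
  also have "\<dots> \<le> real (Suc n) * (real (Suc n) ^ Suc n * exp (- 1) * exp (1 - real n))"
    using * by (intro mult_left_mono mult_right_mono) auto
  also have "\<dots> = real (Suc n) ^ Suc (Suc n) * exp (1 - real (Suc n))"
    by (simp add: mult_exp_exp)
  finally show ?case .
qed simp

text \<open>Serves \<open>h = c - X\<close>, where \<open>h(n) = - m\<close>. The remainder term
  suffices: \<open>(n+1)!\<close> is at most \<open>(n+1) ^ (c+1) * m!\<close>, and the Stirling
  bound handles \<open>m!\<close>.\<close>

lemma fact_le_scaled_exp_neg:
  assumes "even n" "n = m + c" "m > 0"
  shows "fact n \<le> real_of_int (scaled_exp (- int m) n) * (exp 1 * real (Suc n) ^ Suc c)"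
proof -
  have "fact (Suc n) \<le> Suc n ^ Suc c * (fact m :: nat)"
  proof -
    have "fact (Suc n) div fact (Suc n - Suc c) \<le> Suc n ^ Suc c"
      using assms(2) by (intro fact_div_fact_le_pow) simp
    moreover have "fact (Suc n) = fact (Suc n) div fact m * (fact m :: nat)"
      using assms(2) fact_dvd[of m "Suc n", where ?'a = nat] by (simp del: fact_Suc)
    ultimately show ?thesis
      using assms(2) by (metis add_Suc_right diff_add_inverse2 mult_le_mono1)
  qed
  then have "real (fact (Suc n)) \<le> real (Suc n ^ Suc c * fact m)"
    by (simp only: of_nat_le_iff)
  then have "fact (Suc n) \<le> real (Suc n) ^ Suc c * fact m"
    by (simp only: of_nat_mult of_nat_power of_nat_fact)
  also have "\<dots> \<le> real (Suc n) ^ Suc c * (real m ^ Suc n * exp (1 - real m))"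
  proof -
    have "fact m \<le> real m ^ Suc m * exp (1 - real m)"
      using assms(3) by (rule fact_le_exp)
    also have "\<dots> \<le> real m ^ Suc n * exp (1 - real m)"
      using assms by (intro mult_right_mono power_increasing) auto
    finally show ?thesis
      by (intro mult_left_mono) auto
  qed
  finally have "1 \<le> exp (- real m) * (real m ^ Suc n / fact (Suc n)) * (exp 1 * real (Suc n) ^ Suc c)"
    by (simp add: field_simps exp_diff exp_minus del: fact_Suc of_nat_Suc power_Suc)
  also have "\<dots> \<le> exp (- real m) * (1 + real m ^ Suc n / fact (Suc n)) * (exp 1 * real (Suc n) ^ Suc c)"
    by (intro mult_left_mono mult_right_mono) auto
  finally have "fact n * 1 \<le> fact n * (exp (- real m) * (1 + real m ^ Suc n / fact (Suc n))
      * (exp 1 * real (Suc n) ^ Suc c))"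
    by (intro mult_left_mono) auto
  also have "\<dots> = (fact n * exp (- real m) * (1 + real m ^ Suc n / fact (Suc n)))
      * (exp 1 * real (Suc n) ^ Suc c)"
    by (simp only: mult.assoc)
  also have "\<dots> \<le> real_of_int (scaled_exp (- int m) n) * (exp 1 * real (Suc n) ^ Suc c)"
    using scaled_exp_neg_even[OF assms(1), of "int m"] by (intro mult_right_mono) auto
  finally show ?thesis
    by simp
qed

section \<open>Eventual behaviour of integer polynomials\<close>

lemma eventually_poly_pos:
  fixes h :: "int poly"
  assumes "lead_coeff h > 0"
  shows "eventually (\<lambda>n. poly h (int n) > 0) sequentially"
  using assms
proof (induction h)
  case (pCons a p)
  show ?case
  proof (cases "p = 0")
    case False
    then have "eventually (\<lambda>n. poly p (int n) > 0) sequentially"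
      using pCons by simp
    moreover have "eventually (\<lambda>n. n > nat \<bar>a\<bar>) sequentially"
      by (rule eventually_gt_at_top)
    ultimately show ?thesis
    proof eventually_elim
      case (elim n)
      then have "int n * 1 \<le> int n * poly p (int n)"
        by (intro mult_left_mono) auto
      then have "int n \<le> int n * poly p (int n)" by simp
      with elim show ?case unfolding poly_pCons by linarith
    qed
  qed (use pCons in simp)
qed simp

text \<open>The split is by the sign of the leading coefficient and the degree. The bound in
  \<open>neg\<close> is the one under which the summands increase in absolute value;
  \<open>const\<close> and \<open>lin\<close> are what escapes both size estimates.\<close>

lemma poly_eventually_cases:
  fixes h :: "int poly"
  assumes "h \<noteq> 0"
  obtains
    (pos) "eventually (\<lambda>n. poly h (int n) > 0) sequentially"
  | (neg) "eventually (\<lambda>n. - poly h (int n) \<ge> int n + 1) sequentially"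
  | (const) m where "h = [:- m:]" "m > 0"
  | (lin) c where "h = [:c, - 1:]" "c \<ge> 0"
proof -
  consider "lead_coeff h > 0" | "lead_coeff h < 0" "degree h = 0" | "lead_coeff h < 0" "degree h = 1"
    | "lead_coeff h < 0" "degree h \<ge> 2"
    using assms by (metis One_nat_def leading_coeff_0_iff less_2_cases linorder_neqE not_less)
  then show thesis
  proof cases
    case 1
    then show ?thesis by (intro pos eventually_poly_pos)
  next
    case 2
    then obtain a where "h = [:a:]"
      using degree_eq_zeroE by blast
    then show ?thesis using 2 const[of "- a"] by simp
  next
    case 3
    then obtain a b where h: "h = [:b, a:]"
      by (metis One_nat_def degree_eq_zeroE degree_pCons_eq_if nat.simps(1) pCons_cases zero_neq_one)
    then have a: "a < 0" using 3 by (simp split: if_splits)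
    consider "a = - 1" "b \<ge> 0" | "a = - 1" "b < 0" | "a \<le> - 2"
      using a by linarith
    then show ?thesis
    proof cases
      case 1
      then show ?thesis using lin h by simp
    next
      case 2
      then show ?thesis using h by (intro neg) simp
    next
      case 3
      have "eventually (\<lambda>n. n > nat \<bar>b\<bar>) sequentially"
        by (rule eventually_gt_at_top)
      then have "eventually (\<lambda>n. - poly h (int n) \<ge> int n + 1) sequentially"
      proof eventually_elim
        case (elim n)
        then have "int n * a \<le> int n * - 2"
          using 3 by (intro mult_left_mono) auto
        with elim show ?case using h by simp
      qed
      then show ?thesis by (rule neg)
    qed
  next
    case 4
    \<comment> \<open>In degree at least 2, subtracting \<open>X + 1\<close> from \<open>- h\<close>
      leaves the positive leading coefficient unchanged.\<close>
    have "lead_coeff ([:- 1, - 1:] + - h) = lead_coeff (- h)"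
      using 4 by (intro lead_coeff_add_le) auto
    then have "eventually (\<lambda>n. poly ([:- 1, - 1:] + - h) (int n) > 0) sequentially"
      using 4 by (intro eventually_poly_pos) (simp add: lead_coeff_minus)
    then show ?thesis
      by (intro neg) (auto elim: eventually_mono)
  qed
qed

section \<open>Consequences of finitely many Schenker primes\<close>

lemma poly_dvd_diff:
  fixes h :: "int poly"
  shows "x dvd poly h x - poly h 0"
  by (cases h) simp

lemma finite_schenker_primesE:
  assumes "finite {p. schenker_prime h p}"
  obtains M where "M > 0"
    and "\<And>n p. M dvd n \<Longrightarrow> prime p \<Longrightarrow> int p dvd scaled_exp (poly h (int n)) n
      \<Longrightarrow> int p dvd poly h (int n)"
proof
  let ?P = "{p. schenker_prime h p}"
  show "\<Prod>?P > 0"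
    by (intro prod_pos) (auto simp: schenker_prime_def prime_gt_0_nat)
  fix n p
  assume n: "\<Prod>?P dvd n" "prime p" "int p dvd scaled_exp (poly h (int n)) n"
  show "int p dvd poly h (int n)"
  proof (rule ccontr)
    assume nd: "\<not> int p dvd poly h (int n)"
    then have "p \<in> ?P"
      using n by (auto simp: schenker_prime_def schenker_sum_eq)
    then have "p dvd \<Prod>?P"
      using assms by (intro dvd_prod_eqI[where a = p]) auto
    then have "p dvd n"
      using n(1) by (rule dvd_trans)
    then show False
      using scaled_exp_not_dvd[of p n] n(2,3) nd by blast
  qed
qed

lemma schenker_primes_bound:
  fixes q :: nat
  assumes "finite {p. schenker_prime h p}" "prime q" "\<not> int q dvd poly h 0"
  obtains L where "L > 0"
    and "\<And>t. real_of_int \<bar>scaled_exp (poly h (int (2 * L * t))) (2 * L * t)\<bar> * 2 ^ t \<le> fact (2 * L * t)"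
proof -
  obtain M where M: "M > 0" "\<And>n p. M dvd n \<Longrightarrow> prime p \<Longrightarrow> int p dvd scaled_exp (poly h (int n)) n
      \<Longrightarrow> int p dvd poly h (int n)"
    using finite_schenker_primesE[OF assms(1)] by blast
  show thesis
  proof
    show "q * M > 0"
      using M(1) assms(2) prime_gt_0_nat by simp
    fix t
    \<comment> \<open>\<open>M\<close> confines the prime divisors of the sum to those of
      \<open>h(n)\<close>, \<open>q\<close> gives \<open>h(n)\<close> the residue of
      \<open>h(0)\<close> modulo \<open>q\<close>, and 2 makes \<open>n\<close> even for the Taylor
      bound.\<close>
    define n where "n = 2 * (q * M) * t"
    let ?S = "scaled_exp (poly h (int n)) n"
    have "int q dvd int n"
      unfolding n_def by (simp add: mult.assoc)
    then have "int q dvd poly h (int n) - poly h 0"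
      using poly_dvd_diff by (rule dvd_trans)
    then have nd: "\<not> int q dvd poly h (int n)"
      using assms(3) dvd_diff[of "int q" "poly h (int n)" "poly h (int n) - poly h 0"] by auto
    have "t \<le> n div q"
      using M(1) assms(2) prime_gt_0_nat[of q] by (simp add: n_def mult.assoc)
    then have "(2::int) ^ t \<le> int q ^ (n div q)"
      using prime_ge_2_nat[OF assms(2)] by (intro order_trans[OF power_increasing power_mono]) auto
    then have "\<bar>?S\<bar> * 2 ^ t \<le> \<bar>?S\<bar> * int q ^ (n div q)"
      by (intro mult_left_mono) auto
    also have "\<dots> \<le> fact n"
      using M(2)[of n] assms(2) nd
      by (intro scaled_exp_times_prime_power_le_fact) (auto simp: n_def)
    finally have "real_of_int (\<bar>?S\<bar> * 2 ^ t) \<le> real_of_int (fact n)"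
      by (simp only: of_int_le_iff)
    then show "real_of_int \<bar>scaled_exp (poly h (int (2 * (q * M) * t))) (2 * (q * M) * t)\<bar> * 2 ^ t
        \<le> fact (2 * (q * M) * t)"
      by (simp add: n_def)
  qed
qed

section \<open>Contradiction for each type of polynomial\<close>

theorem theorem18:
  fixes h :: "int poly"
  assumes "h \<noteq> 0"
  shows "infinite {p :: nat. schenker_prime h p}"
proof
  assume fin: "finite {p. schenker_prime h p}"
  have small: "\<not> eventually (\<lambda>n. \<bar>scaled_exp (poly h (int n)) n\<bar> > fact n) sequentially"
  proof
    assume "eventually (\<lambda>n. \<bar>scaled_exp (poly h (int n)) n\<bar> > fact n) sequentially"
    then obtain N where N: "\<And>n. n \<ge> N \<Longrightarrow> \<bar>scaled_exp (poly h (int n)) n\<bar> > fact n"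
      by (auto simp: eventually_sequentially)
    obtain M where M: "M > 0" "\<And>n p. M dvd n \<Longrightarrow> prime p \<Longrightarrow> int p dvd scaled_exp (poly h (int n)) n
        \<Longrightarrow> int p dvd poly h (int n)"
      using finite_schenker_primesE[OF fin] by blast
    \<comment> \<open>\<open>M * N\<close> is a multiple of \<open>M\<close> and at least
      \<open>N\<close>, so divisibility and size clash there.\<close>
    have "scaled_exp (poly h (int (M * N))) (M * N) dvd fact (M * N)"
      using M(2)[of "M * N"] by (intro scaled_exp_dvd_fact) auto
    then have "\<bar>scaled_exp (poly h (int (M * N))) (M * N)\<bar> \<le> \<bar>fact (M * N)\<bar>"
      by (intro dvd_imp_le_int) auto
    then show False
      using N[of "M * N"] M(1) by simp
  qed
  have prime: "\<exists>q. prime q \<and> \<not> int q dvd a" if "a \<noteq> 0" for a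
  proof -
    obtain q where "prime q" "nat \<bar>a\<bar> < q"
      using bigger_prime by blast
    then show ?thesis
      using that dvd_imp_le_int[of a "int q"] by (intro exI[of _ q]) auto
  qed
  show False
    using assms
  proof (cases rule: poly_eventually_cases)
    case pos
    from pos eventually_gt_at_top[of 0]
    have "eventually (\<lambda>n. \<bar>scaled_exp (poly h (int n)) n\<bar> > fact n) sequentially"
    proof eventually_elim
      case (elim n)
      then show ?case
        using scaled_exp_gt_fact[of "poly h (int n)" n] by simp
    qed
    with small show False ..
  next
    case neg
    from neg eventually_ge_at_top[of 2]
    have "eventually (\<lambda>n. \<bar>scaled_exp (poly h (int n)) n\<bar> > fact n) sequentially"
    proof eventually_elim
      case (elim n)
      then show ?case
        using scaled_exp_neg_large[of n "- poly h (int n)"] by simp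
    qed
    with small show False ..
  next
    case (const m)
    obtain q where "prime q" "\<not> int q dvd poly h 0"
      using prime[of "poly h 0"] const by auto
    with fin obtain L where L: "L > 0"
      "\<And>t. real_of_int \<bar>scaled_exp (poly h (int (2 * L * t))) (2 * L * t)\<bar> * 2 ^ t \<le> fact (2 * L * t)"
      using schenker_primes_bound by blast
    obtain t where t: "exp (real_of_int m) < 2 ^ t"
      using real_arch_pow[of 2] by auto
    let ?n = "2 * L * t"
    let ?S = "real_of_int (scaled_exp (- m) ?n)"
    have "fact ?n * exp (- real_of_int m) * 1 \<le> fact ?n * exp (- real_of_int m) * (1 + real_of_int m ^ Suc ?n / fact (Suc ?n))"
      using const by (intro mult_left_mono) auto
    also have "\<dots> \<le> ?S"
      using const by (intro scaled_exp_neg_even) auto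
    finally have S: "fact ?n * exp (- real_of_int m) \<le> ?S" by simp
    then have "?S > 0"
      by (rule less_le_trans[rotated]) simp
    have "fact ?n \<le> ?S * exp (real_of_int m)"
      using S by (simp add: exp_minus field_simps)
    also have "\<dots> < ?S * 2 ^ t"
      using t \<open>?S > 0\<close> by (rule mult_strict_left_mono)
    also have "\<dots> \<le> fact ?n"
      using L(2)[of t] const by (simp add: mult_right_mono[OF abs_ge_self, THEN order_trans])
    finally show False by simp
  next
    case (lin c)
    show False
    proof (cases "c = 0")
      case True
      \<comment> \<open>For \<open>h = - X\<close> the sum at 1 is \<open>1 + h(1) = 0\<close>, so
        every prime divides it while none divides \<open>h(1) = - 1\<close>.\<close>
      have "scaled_exp (poly h (int 1)) 1 = 0" "\<bar>poly h (int 1)\<bar> = 1"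
        using lin True by (simp_all add: scaled_exp_def)
      then have "schenker_prime h p" if "prime p" for p
        unfolding schenker_prime_def schenker_sum_eq using that
        by (metis dvd_0_right dvd_abs_iff not_prime_unit prime_int_nat_transfer prime_nat_int_transfer)
      then have "{p. prime p} \<subseteq> {p. schenker_prime h p}"
        by blast
      then show False
        using fin primes_infinite finite_subset by blast
    next
      case False
      define d where "d = nat c"
      have d: "c = int d" "d > 0"
        using lin False by (auto simp: d_def)
      obtain q where "prime q" "\<not> int q dvd poly h 0"
        using prime[of "poly h 0"] lin False by auto
      with fin obtain L where L: "L > 0"
        "\<And>t. real_of_int \<bar>scaled_exp (poly h (int (2 * L * t))) (2 * L * t)\<bar> * 2 ^ t \<le> fact (2 * L * t)"
        using schenker_primes_bound by blast
      have "real (2 * L) > 0"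
        using L(1) by simp
      \<comment> \<open>The base is \<open>n + 1\<close> for \<open>n = 2 * L * t\<close>: the
        polynomial loss in the lower bound is beaten by \<open>2 ^ t\<close>.\<close>
      then have "eventually (\<lambda>t. exp 1 * (real (2 * L) * real t + 1) ^ Suc d < 2 ^ t) sequentially"
        by real_asymp
      then have "eventually (\<lambda>t. t > d \<and> exp 1 * (real (2 * L) * real t + 1) ^ Suc d < 2 ^ t) sequentially"
        using eventually_gt_at_top[of d] by (simp add: eventually_conj_iff)
      then obtain t where t: "t > d" "exp 1 * (real (2 * L) * real t + 1) ^ Suc d < 2 ^ t"
        using eventually_happens'[OF sequentially_bot] by blast
      define n where "n = 2 * L * t"
      let ?S = "real_of_int (scaled_exp (- int (n - d)) n)"
      have "t \<le> n"
        using L(1) by (simp add: n_def)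
      with t(1) have n: "n = (n - d) + d" "n - d > 0" by auto
      have S: "fact n \<le> ?S * (exp 1 * real (Suc n) ^ Suc d)"
        using n by (intro fact_le_scaled_exp_neg) (auto simp: n_def)
      have "?S > 0"
      proof (rule ccontr)
        assume "\<not> ?S > 0"
        then have "?S * (exp 1 * real (Suc n) ^ Suc d) \<le> 0"
          by (intro mult_nonpos_nonneg) auto
        with S have "fact n \<le> (0::real)" by (rule order_trans)
        then show False
          using fact_gt_zero[of n, where ?'a = real] by linarith
      qed
      have "fact n < ?S * 2 ^ t"
        using t(2) \<open>?S > 0\<close> by (intro le_less_trans[OF S] mult_strict_left_mono) (auto simp: n_def add.commute)
      also have "\<dots> \<le> \<bar>?S\<bar> * 2 ^ t"
        by (intro mult_right_mono) auto
      also have "\<dots> \<le> fact n"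
        using L(2)[of t] n lin d by (simp add: n_def[symmetric] of_nat_diff)
      finally show False by simp
    qed
  qed
qed

end
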